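(* Let $(\Omega,\sigma)$ be a subshift of finite type described by an $n\times n$ transition matrix $M$ with entries in $\{0,1\}$, and let $\overline{\sigma}$ be the induced map on the hyperspace $\mathcal{K}(\Omega)$ of nonempty compact subsets of $\Omega$. Then $(\Omega,\sigma)$ is sensitive if and only if $(\mathcal{K}(\Omega),\overline{\sigma})$ is sensitive.
   Context: For a $\{0,1\}$-matrix $M=(m_{ij})_{1\le i,j\le n}$, the subshift of finite type is $\Omega=\Sigma_M=\{(x_i)_{i\ge 0}\in\{1,\dots,n\}^{\mathbb{N}}: m_{x_ix_{i+1}}=1 \text{ for all } i\ge 0\}$, with $\sigma(x_0x_1x_2\ldots)=x_1x_2x_3\ldots$ and metric $D(\bar x,\bar y)=\sum_{i=0}^\infty\frac{\delta(x_i,y_i)}{2^i}$, $\delta$ the discrete metric. $\mathcal{K}(\Omega)$ carries the Hausdorff metric $D_H$ induced by $D$, and $\overline{\sigma}(K)=\sigma(K)$. A continuous self-map $f$ of a metric space $(X,\rho)$ is sensitive if there is $\delta>0$ such that for every $x\in X$ and every $\epsilon>0$ there exist $y\in X$ and a positive integer $n$ with $\rho(x,y)<\epsilon$ and $\rho(f^n(x),f^n(y))>\delta$. *)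

theory Defs
  imports "HOL-Analysis.Analysis"
begin

text \<open>
  Continuity of \<open>f\<close>, which is presupposed when speaking of a sensitive system, is not part of
  the definition; for the two maps considered below it is proved at the end of this theory.
\<close>

definition sensitive :: "'a set \<Rightarrow> ('a \<Rightarrow> 'a \<Rightarrow> real) \<Rightarrow> ('a \<Rightarrow> 'a) \<Rightarrow> bool" where
  "sensitive X \<rho> f \<longleftrightarrow>
     (\<exists>\<delta>>0. \<forall>x\<in>X. \<forall>\<epsilon>>0. \<exists>y\<in>X. \<exists>n>0. \<rho> x y < \<epsilon> \<and> \<rho> ((f ^^ n) x) ((f ^^ n) y) > \<delta>)"

definition hyperspace :: "'a set \<Rightarrow> ('a \<Rightarrow> 'a \<Rightarrow> real) \<Rightarrow> 'a set set" where
  "hyperspace X d = {K. K \<noteq> {} \<and> compactin (Metric_space.mtopology X d) K}"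

text \<open>Only meaningful for nonempty bounded sets; in particular on \<^const>\<open>hyperspace\<close>.\<close>

definition hausdorff_dist :: "('a \<Rightarrow> 'a \<Rightarrow> real) \<Rightarrow> 'a set \<Rightarrow> 'a set \<Rightarrow> real" where
  "hausdorff_dist d A B = max (SUP a\<in>A. INF b\<in>B. d a b) (SUP b\<in>B. INF a\<in>A. d a b)"

text \<open>
  The alphabet \<open>{1,\<dots>,n}\<close> is the index type \<open>'n\<close> of the matrix, so \<open>n = CARD('n) \<ge> 1\<close>.
\<close>

definition SFT :: "int ^ 'n ^ 'n \<Rightarrow> (nat \<Rightarrow> 'n) set" where
  "SFT M = {x. \<forall>i. M $ x i $ x (Suc i) = 1}"

definition seq_dist :: "(nat \<Rightarrow> 'a) \<Rightarrow> (nat \<Rightarrow> 'a) \<Rightarrow> real" where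
  "seq_dist x y = (\<Sum>i. discrete_metric.dd (x i) (y i) / 2 ^ i)"

definition shift :: "(nat \<Rightarrow> 'a) \<Rightarrow> nat \<Rightarrow> 'a" where
  "shift x = (\<lambda>i. x (Suc i))"


subsection \<open>The Hausdorff distance is a metric on the hyperspace\<close>

lemma hausdorff_dist_commute:
  assumes "\<And>x y. d x y = d y x"
  shows "hausdorff_dist d A B = hausdorff_dist d B A"
proof -
  have "hausdorff_dist d A B = hausdorff_dist (\<lambda>x y. d y x) A B"
    by (rule arg_cong[where f = "\<lambda>e. hausdorff_dist e A B"]) (intro ext assms)
  also have "\<dots> = hausdorff_dist d B A" by (simp add: hausdorff_dist_def max.commute)
  finally show ?thesis .
qed

context Metric_space
begin

lemma hyperspaceD:
  assumes "K \<in> hyperspace M d"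
  shows "K \<noteq> {}" "K \<subseteq> M" "compactin mtopology K"
  using assms compactin_subset_topspace by (fastforce simp: hyperspace_def)+

lemma hyperspace_inf_attained:
  assumes B: "B \<in> hyperspace M d" and a: "a \<in> M"
  obtains b where "b \<in> B" "(INF b\<in>B. d a b) = d a b"
proof -
  have lip: "dist (d a x) (d a y) \<le> d x y" if "x \<in> M" "y \<in> M" for x y
    using triangle[of a x y] triangle[of a y x] commute[of x y] a that by (simp add: dist_real_def)
  have "continuous_map mtopology (Metric_space.mtopology UNIV dist) (d a)"
    unfolding metric_continuous_map[OF Met_TC.Metric_space_axioms]
    using lip by (meson le_less_trans subset_UNIV)
  then have "continuous_map mtopology euclideanreal (d a)" by simp
  then have "compact (d a ` B)"
    using image_compactin [of mtopology B euclideanreal "d a"] hyperspaceD(3)[OF B] by simp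
  moreover have "d a ` B \<noteq> {}" using hyperspaceD(1)[OF B] by simp
  ultimately obtain b where "b \<in> B" "\<And>c. c \<in> B \<Longrightarrow> d a b \<le> d a c"
    using compact_attains_inf[of "d a ` B"] by auto
  then have "(INF b\<in>B. d a b) = d a b"
    by (intro cInf_eq_minimum) auto
  with that \<open>b \<in> B\<close> show ?thesis by blast
qed

lemma hyperspace_inf_le_iff:
  assumes B: "B \<in> hyperspace M d" and a: "a \<in> M"
  shows "(INF b\<in>B. d a b) \<le> r \<longleftrightarrow> (\<exists>b\<in>B. d a b \<le> r)"
proof
  assume "(INF b\<in>B. d a b) \<le> r"
  then show "\<exists>b\<in>B. d a b \<le> r" by (metis hyperspace_inf_attained[OF B a])
next
  assume "\<exists>b\<in>B. d a b \<le> r"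
  then obtain b where b: "b \<in> B" "d a b \<le> r" by blast
  have "bdd_below (d a ` B)" by (rule bdd_belowI[of _ 0]) auto
  then have "(INF b\<in>B. d a b) \<le> d a b" using b(1) by (intro cINF_lower)
  with b show "(INF b\<in>B. d a b) \<le> r" by linarith
qed

lemma hyperspace_excess_le_iff:
  assumes A: "A \<in> hyperspace M d" and B: "B \<in> hyperspace M d"
  shows "(SUP a\<in>A. INF b\<in>B. d a b) \<le> r \<longleftrightarrow> (\<forall>a\<in>A. \<exists>b\<in>B. d a b \<le> r)"
proof -
  obtain b where b: "b \<in> B" using hyperspaceD(1)[OF B] by blast
  have bM: "b \<in> M" using b hyperspaceD(2)[OF B] by blast
  have "mbounded A" using compactin_imp_mbounded hyperspaceD(3)[OF A] by blast
  then obtain c s where cs: "A \<subseteq> mcball c s" by (auto simp: mbounded_def)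
  have bd: "bdd_above ((\<lambda>a. INF b\<in>B. d a b) ` A)"
  proof (rule bdd_aboveI2)
    fix a assume a: "a \<in> A"
    then have "a \<in> M" "c \<in> M" "d c a \<le> s" using cs by auto
    then have "d a b \<le> s + d c b" using triangle[of a c b] bM commute[of a c] by linarith
    then show "(INF b\<in>B. d a b) \<le> s + d c b"
      using hyperspace_inf_le_iff[OF B \<open>a \<in> M\<close>] b by blast
  qed
  have "(SUP a\<in>A. INF b\<in>B. d a b) \<le> r \<longleftrightarrow> (\<forall>a\<in>A. (INF b\<in>B. d a b) \<le> r)"
    by (rule cSUP_le_iff[OF hyperspaceD(1)[OF A] bd])
  also have "\<dots> \<longleftrightarrow> (\<forall>a\<in>A. \<exists>b\<in>B. d a b \<le> r)"
    using hyperspace_inf_le_iff[OF B] hyperspaceD(2)[OF A] by blast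
  finally show ?thesis .
qed

lemma hausdorff_dist_le_iff:
  assumes A: "A \<in> hyperspace M d" and B: "B \<in> hyperspace M d"
  shows "hausdorff_dist d A B \<le> r \<longleftrightarrow>
    (\<forall>a\<in>A. \<exists>b\<in>B. d a b \<le> r) \<and> (\<forall>b\<in>B. \<exists>a\<in>A. d a b \<le> r)"
  using hyperspace_excess_le_iff[OF A B, of r] hyperspace_excess_le_iff[OF B A, of r]
  unfolding hausdorff_dist_def by (simp add: commute)

lemma hausdorff_dist_nonneg:
  assumes A: "A \<in> hyperspace M d" and B: "B \<in> hyperspace M d"
  shows "0 \<le> hausdorff_dist d A B"
proof -
  obtain a where "a \<in> A" using hyperspaceD(1)[OF A] by blast
  then obtain b where "d a b \<le> hausdorff_dist d A B"
    using hausdorff_dist_le_iff[OF A B, of "hausdorff_dist d A B"] by blast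
  then show ?thesis using nonneg[of a b] by linarith
qed

lemma hausdorff_dist_eq_0_iff:
  assumes A: "A \<in> hyperspace M d" and B: "B \<in> hyperspace M d"
  shows "hausdorff_dist d A B = 0 \<longleftrightarrow> A = B"
proof -
  have z: "d x y \<le> 0 \<longleftrightarrow> x = y" if "x \<in> M" "y \<in> M" for x y
    using zero[OF that] nonneg[of x y] by linarith
  have "hausdorff_dist d A B = 0 \<longleftrightarrow> hausdorff_dist d A B \<le> 0"
    using hausdorff_dist_nonneg[OF A B] by linarith
  also have "\<dots> \<longleftrightarrow> (\<forall>a\<in>A. \<exists>b\<in>B. a = b) \<and> (\<forall>b\<in>B. \<exists>a\<in>A. a = b)"
    unfolding hausdorff_dist_le_iff[OF A B]
    by (intro arg_cong2[where f = "(\<and>)"] ball_cong bex_cong refl z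
        subsetD[OF hyperspaceD(2)[OF A]] subsetD[OF hyperspaceD(2)[OF B]])
  finally show ?thesis by blast
qed

lemma hausdorff_dist_triangle:
  assumes A: "A \<in> hyperspace M d" and B: "B \<in> hyperspace M d" and C: "C \<in> hyperspace M d"
  shows "hausdorff_dist d A C \<le> hausdorff_dist d A B + hausdorff_dist d B C"
proof -
  have sub: "A \<subseteq> M" "B \<subseteq> M" "C \<subseteq> M" using hyperspaceD(2) A B C by blast+
  have AB: "\<forall>a\<in>A. \<exists>b\<in>B. d a b \<le> hausdorff_dist d A B"
           "\<forall>b\<in>B. \<exists>a\<in>A. d a b \<le> hausdorff_dist d A B"
    using hausdorff_dist_le_iff[OF A B, of "hausdorff_dist d A B"] by blast+
  have BC: "\<forall>b\<in>B. \<exists>c\<in>C. d b c \<le> hausdorff_dist d B C"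
           "\<forall>c\<in>C. \<exists>b\<in>B. d b c \<le> hausdorff_dist d B C"
    using hausdorff_dist_le_iff[OF B C, of "hausdorff_dist d B C"] by blast+
  have t: "d a c \<le> hausdorff_dist d A B + hausdorff_dist d B C"
    if "a \<in> A" "b \<in> B" "c \<in> C" "d a b \<le> hausdorff_dist d A B" "d b c \<le> hausdorff_dist d B C"
    for a b c
    using that sub triangle[of a b c] by (meson add_mono order_trans subsetD)
  show ?thesis
    unfolding hausdorff_dist_le_iff[OF A C] using AB BC t by meson
qed

end


subsection \<open>The shift and the induced map are continuous self-maps\<close>

lemma dd_bounds: "0 \<le> discrete_metric.dd x y" "discrete_metric.dd x y \<le> 1"
  by (simp_all add: discrete_metric.dd_def)

lemma summable_seq_dist: "summable (\<lambda>i. discrete_metric.dd (x i) (y i) / 2 ^ i)"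
proof (rule summable_comparison_test)
  show "summable (\<lambda>i. (1/2::real) ^ i)" by (simp add: summable_geometric)
  show "\<exists>N. \<forall>i\<ge>N. norm (discrete_metric.dd (x i) (y i) / 2 ^ i) \<le> (1/2) ^ i"
    by (simp add: dd_bounds power_divide divide_right_mono)
qed

lemma Metric_space_seq_dist: "Metric_space X seq_dist"
proof
  fix x y z :: "nat \<Rightarrow> 'a"
  show "0 \<le> seq_dist x y"
    unfolding seq_dist_def by (intro suminf_nonneg summable_seq_dist) (simp add: dd_bounds)
  show "seq_dist x y = seq_dist y x"
    unfolding seq_dist_def by (simp add: discrete_metric.dd_def eq_commute)
  have "seq_dist x y = 0 \<longleftrightarrow> (\<forall>i. discrete_metric.dd (x i) (y i) / 2 ^ i = 0)"
    unfolding seq_dist_def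
    by (intro suminf_eq_zero_iff summable_seq_dist) (simp add: dd_bounds)
  then show "seq_dist x y = 0 \<longleftrightarrow> x = y"
    by (auto simp: discrete_metric.dd_def fun_eq_iff)
  have "seq_dist x z
      \<le> (\<Sum>i. discrete_metric.dd (x i) (y i) / 2 ^ i + discrete_metric.dd (y i) (z i) / 2 ^ i)"
    unfolding seq_dist_def
    by (intro suminf_le summable_add summable_seq_dist)
       (auto simp: discrete_metric.dd_def)
  also have "\<dots> = seq_dist x y + seq_dist y z"
    unfolding seq_dist_def by (intro suminf_add[symmetric] summable_seq_dist)
  finally show "seq_dist x z \<le> seq_dist x y + seq_dist y z" .
qed

lemma shift_SFT: "x \<in> SFT M \<Longrightarrow> shift x \<in> SFT M"
  by (simp add: SFT_def shift_def)

lemma seq_dist_shift_le: "seq_dist (shift x) (shift y) \<le> 2 * seq_dist x y"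
proof -
  let ?f = "\<lambda>i. discrete_metric.dd (x i) (y i) / 2 ^ i"
  have "2 * (\<Sum>i. ?f (Suc i)) = (\<Sum>i. 2 * ?f (Suc i))"
    by (rule suminf_mult[symmetric])
       (rule summable_Suc_iff[THEN iffD2, OF summable_seq_dist[of x y]])
  then have "seq_dist (shift x) (shift y) = 2 * (\<Sum>i. ?f (Suc i))"
    by (simp add: seq_dist_def shift_def)
  also have "(\<Sum>i. ?f (Suc i)) = seq_dist x y - ?f 0"
    using suminf_split_head[OF summable_seq_dist[of x y]] by (simp add: seq_dist_def)
  finally show ?thesis using dd_bounds(1)[of "x 0" "y 0"] by simp
qed

lemma continuous_map_shift:
  "continuous_map (Metric_space.mtopology (SFT M) seq_dist)
     (Metric_space.mtopology (SFT M) seq_dist) shift"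
proof -
  interpret Metric_space "SFT M" seq_dist by (rule Metric_space_seq_dist)
  show ?thesis
    unfolding metric_continuous_map[OF Metric_space_axioms]
  proof (intro conjI ballI allI impI)
    show "shift ` SFT M \<subseteq> SFT M" using shift_SFT by blast
    fix \<epsilon> :: real and x assume e: "(0::real) < \<epsilon>"
    show "\<exists>\<delta>>0. \<forall>y. y \<in> SFT M \<and> seq_dist x y < \<delta> \<longrightarrow> seq_dist (shift x) (shift y) < \<epsilon>"
    proof (intro exI[of _ "\<epsilon> / 2"] conjI allI impI)
      fix y assume "y \<in> SFT M \<and> seq_dist x y < \<epsilon> / 2"
      then show "seq_dist (shift x) (shift y) < \<epsilon>" using seq_dist_shift_le[of x y] by linarith
    qed (use e in simp)
  qed
qed

lemma image_shift_hyperspace: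
  assumes "K \<in> hyperspace (SFT M) seq_dist"
  shows "shift ` K \<in> hyperspace (SFT M) seq_dist"
  using assms image_compactin[OF _ continuous_map_shift] by (auto simp: hyperspace_def)

lemma hausdorff_dist_image_shift_le:
  fixes M :: "int ^ 'a ^ 'a"
  assumes A: "A \<in> hyperspace (SFT M) seq_dist" and B: "B \<in> hyperspace (SFT M) seq_dist"
  shows "hausdorff_dist seq_dist (shift ` A) (shift ` B) \<le> 2 * hausdorff_dist seq_dist A B"
proof -
  interpret Metric_space "SFT M" seq_dist by (rule Metric_space_seq_dist)
  let ?h = "hausdorff_dist seq_dist A B"
  have step: "seq_dist (shift x) (shift y) \<le> 2 * ?h" if "seq_dist x y \<le> ?h"
    for x y :: "nat \<Rightarrow> 'a"
    using that seq_dist_shift_le[of x y] by linarith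
  have "\<forall>a\<in>A. \<exists>b\<in>B. seq_dist a b \<le> ?h" "\<forall>b\<in>B. \<exists>a\<in>A. seq_dist a b \<le> ?h"
    using hausdorff_dist_le_iff[OF A B, of ?h] by blast+
  then show ?thesis
    unfolding hausdorff_dist_le_iff[OF image_shift_hyperspace[OF A] image_shift_hyperspace[OF B]]
    using step by fast
qed

end

theory Submission
  imports Defs
begin

text \<open>
  Sensitivity of the hyperspace passes to the space by looking at singletons. For the converse,
  fix a successor function \<open>f\<close> on the letters that begin a point of the subshift. Given a compact
  \<open>K\<close> and a large \<open>N\<close>, follow each point of \<open>K\<close> up to time \<open>N\<close> and then only \<open>f\<close>; this yields a
  finite set \<open>A\<close> close to \<open>K\<close>. Sensitivity forbids isolated points, so some \<open>y\<close> close to a point of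
  \<open>A\<close> makes, at a time \<open>n \<ge> N\<close>, a transition that is not prescribed by \<open>f\<close>. Every point of
  \<open>\<sigma>\<^sup>n(A)\<close> follows \<open>f\<close> and hence differs from \<open>\<sigma>\<^sup>n(y)\<close> in one of the first two letters. Thus
  \<open>\<sigma>\<^sup>n(A)\<close> and \<open>\<sigma>\<^sup>n(A \<union> {y})\<close> are at distance at least \<open>1/2\<close>, and one of them is far from
  \<open>\<sigma>\<^sup>n(K)\<close>.
\<close>

section \<open>From the hyperspace to the space\<close>

lemma funpow_image:
  fixes f :: "'a \<Rightarrow> 'a"
  shows "((\<lambda>K. f ` K) ^^ n) K = (f ^^ n) ` K"
  by (induction n) (simp_all add: image_comp)

lemma sensitive_hyperspace_imp_sensitive:
  assumes "Metric_space X d"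
    and cont: "continuous_map (Metric_space.mtopology X d) (Metric_space.mtopology X d) f"
    and sens: "sensitive (hyperspace X d) (hausdorff_dist d) (\<lambda>K. f ` K)"
  shows "sensitive X d f"
proof -
  interpret Metric_space X d by fact
  have funpow_hyperspace: "(f ^^ n) ` K \<in> hyperspace X d" if "K \<in> hyperspace X d" for K n
  proof (induction n)
    case (Suc n)
    then have "f ` (f ^^ n) ` K \<in> hyperspace X d"
      using image_compactin[OF _ cont] by (auto simp: hyperspace_def)
    then show ?case by (simp add: image_comp)
  qed (use that in simp)
  obtain \<delta> where \<delta>: "\<delta> > 0" and far: "\<And>A \<epsilon>. A \<in> hyperspace X d \<Longrightarrow> \<epsilon> > 0 \<Longrightarrow>
      \<exists>B\<in>hyperspace X d. \<exists>n>0. hausdorff_dist d A B < \<epsilon> \<and>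
        hausdorff_dist d ((f ^^ n) ` A) ((f ^^ n) ` B) > \<delta>"
    using sens unfolding sensitive_def funpow_image by blast
  have "\<exists>y\<in>X. \<exists>n>0. d x y < \<epsilon> \<and> d ((f ^^ n) x) ((f ^^ n) y) > \<delta>" if x: "x \<in> X" and "\<epsilon> > 0" for x \<epsilon>
  proof -
    have sing: "{x} \<in> hyperspace X d"
      using x by (simp add: hyperspace_def finite_imp_compactin)
    obtain B n where B: "B \<in> hyperspace X d" and n: "n > 0"
      and close: "hausdorff_dist d {x} B < \<epsilon>"
      and apart: "hausdorff_dist d ((f ^^ n) ` {x}) ((f ^^ n) ` B) > \<delta>"
      using far[OF sing \<open>\<epsilon> > 0\<close>] by blast
    have "B \<noteq> {}" using hyperspaceD(1)[OF B] .
    then obtain y where y: "y \<in> B" "d ((f ^^ n) x) ((f ^^ n) y) > \<delta>"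
      using apart hausdorff_dist_le_iff[OF funpow_hyperspace[OF sing] funpow_hyperspace[OF B], of n n \<delta>]
      by force
    have "d x y < \<epsilon>"
      using close y(1) hausdorff_dist_le_iff[OF sing B, of "hausdorff_dist d {x} B"] by force
    then show ?thesis using y n hyperspaceD(2)[OF B] by blast
  qed
  then show ?thesis unfolding sensitive_def using \<delta> by blast
qed

section \<open>Distance and agreement of initial letters\<close>

lemma funpow_shift: "(shift ^^ n) x = (\<lambda>i. x (i + n))"
  by (induction n) (simp_all add: shift_def)

lemma seq_dist_eq_shift:
  "seq_dist x y = discrete_metric.dd (x 0) (y 0) + seq_dist (shift x) (shift y) / 2"
proof -
  let ?f = "\<lambda>i. discrete_metric.dd (x i) (y i) / 2 ^ i"
  have "(\<Sum>i. ?f (Suc i)) = seq_dist (shift x) (shift y) / 2"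
    using suminf_divide[OF summable_seq_dist[of "shift x" "shift y"], of 2]
    by (simp add: seq_dist_def shift_def mult.commute)
  then show ?thesis
    using suminf_split_head[OF summable_seq_dist[of x y]] by (simp add: seq_dist_def)
qed

text \<open>Each common first letter can be peeled off, which halves the bound; the base case is the
  geometric sum 2.\<close>

lemma seq_dist_le_if_agree:
  assumes "\<And>i. i < k \<Longrightarrow> x i = y i"
  shows "seq_dist x y \<le> 2 / 2 ^ k"
  using assms
proof (induction k arbitrary: x y)
  case 0
  have "seq_dist x y \<le> (\<Sum>i. (1/2::real) ^ i)"
    unfolding seq_dist_def
    by (intro suminf_le summable_seq_dist summable_geometric)
       (simp_all add: dd_bounds power_divide divide_right_mono)
  also have "\<dots> = 2" by (simp add: suminf_geometric)
  finally show ?case by simp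
next
  case (Suc k)
  have "seq_dist (shift x) (shift y) \<le> 2 / 2 ^ k"
    by (intro Suc.IH) (simp add: shift_def Suc.prems)
  moreover have "x 0 = y 0" by (simp add: Suc.prems)
  ultimately show ?case
    by (simp add: seq_dist_eq_shift[of x y] discrete_metric.dd_def)
qed

lemma seq_dist_ge_if_differ:
  assumes "x k \<noteq> y k"
  shows "1 / 2 ^ k \<le> seq_dist x y"
proof -
  have "(\<Sum>i\<in>{k}. discrete_metric.dd (x i) (y i) / 2 ^ i) \<le> seq_dist x y"
    unfolding seq_dist_def by (intro sum_le_suminf summable_seq_dist) (auto simp: dd_bounds)
  then show ?thesis using assms by (simp add: discrete_metric.dd_def)
qed

lemma seq_dist_less_imp_agree:
  assumes "seq_dist x y < 1 / 2 ^ k" and "i \<le> k"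
  shows "x i = y i"
proof (rule ccontr)
  assume "x i \<noteq> y i"
  then have "1 / 2 ^ i \<le> seq_dist x y" by (rule seq_dist_ge_if_differ)
  moreover have "1 / 2 ^ k \<le> (1 / 2 ^ i :: real)" using \<open>i \<le> k\<close> by (simp add: frac_le power_increasing)
  ultimately show False using assms(1) by linarith
qed

section \<open>Continuation by a successor function\<close>

definition follow :: "('a \<Rightarrow> 'a) \<Rightarrow> nat \<Rightarrow> (nat \<Rightarrow> 'a) \<Rightarrow> nat \<Rightarrow> 'a" where
  "follow f N x i = (if i \<le> N then x i else (f ^^ (i - N)) (x N))"

lemma follow_le [simp]: "i \<le> N \<Longrightarrow> follow f N x i = x i"
  by (simp add: follow_def)

lemma follow_Suc: "N \<le> i \<Longrightarrow> follow f N x (Suc i) = f (follow f N x i)"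
  by (auto simp: follow_def Suc_diff_le)

text \<open>Only the letters at indices 0 to \<open>N\<close> enter \<open>follow f N x\<close>, so
  finitely many words of length \<open>Suc N\<close> determine all values.\<close>

lemma finite_range_follow: "finite (range (follow f N :: (nat \<Rightarrow> 'a::finite) \<Rightarrow> nat \<Rightarrow> 'a))"
proof (rule finite_subset)
  let ?g = "\<lambda>l::'a list. follow f N (\<lambda>i. l ! i)"
  show "range (follow f N) \<subseteq> ?g ` {l. set l \<subseteq> UNIV \<and> length l = Suc N}"
  proof safe
    fix x :: "nat \<Rightarrow> 'a"
    have "follow f N x = ?g (map x [0..<Suc N])"
      by (auto simp: follow_def fun_eq_iff nth_append simp del: upt_Suc)
    moreover have "length (map x [0..<Suc N]) = Suc N" by simp
    ultimately show "follow f N x \<in> ?g ` {l. set l \<subseteq> UNIV \<and> length l = Suc N}" by blast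
  qed
  show "finite (?g ` {l. set l \<subseteq> UNIV \<and> length l = Suc N})"
    by (intro finite_imageI finite_lists_length_eq) simp
qed

lemma funpow_shift_SFT: "x \<in> SFT M \<Longrightarrow> (shift ^^ n) x \<in> SFT M"
  by (induction n) (simp_all add: shift_SFT)

text \<open>Only the letters that begin a point of the subshift matter: other letters may be dead ends.\<close>

lemma SFT_successor:
  obtains f where "\<And>x N. x \<in> SFT M \<Longrightarrow> follow f N x \<in> SFT M"
proof -
  define V where "V = (\<lambda>x. x 0) ` SFT M"
  have "\<exists>w\<in>V. M $ v $ w = 1" if v: "v \<in> V" for v
  proof -
    obtain x where x: "x \<in> SFT M" "v = x 0" using v unfolding V_def by blast
    then have "shift x 0 \<in> V" unfolding V_def using shift_SFT by blast
    moreover have "M $ v $ shift x 0 = 1" using x by (simp add: SFT_def shift_def)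
    ultimately show ?thesis by blast
  qed
  then obtain f where f: "\<And>v. v \<in> V \<Longrightarrow> f v \<in> V" "\<And>v. v \<in> V \<Longrightarrow> M $ v $ f v = 1"
    by metis
  have "follow f N x \<in> SFT M" if x: "x \<in> SFT M" for x N
  proof -
    \<comment> \<open>Since \<open>f\<close> is controlled only on \<open>V\<close>, membership is
      carried along; up to \<open>N\<close> it holds because every letter of \<open>x\<close> begins
      a shifted copy of \<open>x\<close>.\<close>
    have V: "follow f N x i \<in> V" for i
    proof (induction i)
      case 0
      then show ?case using x by (simp add: V_def)
    next
      case (Suc i)
      have "(shift ^^ Suc i) x 0 \<in> V" unfolding V_def using funpow_shift_SFT[OF x] by blast
      then have "x (Suc i) \<in> V" unfolding funpow_shift by simp
      then show ?case
        using f(1)[OF Suc] by (cases "Suc i \<le> N") (simp_all add: follow_Suc)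
    qed
    have "M $ follow f N x i $ follow f N x (Suc i) = 1" for i
      using x f(2)[OF V, of i] by (cases "Suc i \<le> N") (simp_all add: follow_Suc SFT_def)
    then show ?thesis by (simp add: SFT_def)
  qed
  then show ?thesis by (rule that)
qed

text \<open>If \<open>y\<close> obeyed \<open>f\<close> from \<open>N\<close> on, induction from the
  common initial word would give \<open>y = follow f N x\<close>.\<close>

lemma follow_deviation:
  assumes agree: "\<And>i. i \<le> N \<Longrightarrow> y i = follow f N x i" and "y \<noteq> follow f N x"
  obtains n where "N \<le> n" "y (Suc n) \<noteq> f (y n)"
proof -
  have "\<exists>n\<ge>N. y (Suc n) \<noteq> f (y n)"
  proof (rule ccontr)
    assume "\<not> ?thesis"
    then have step: "y (Suc n) = f (y n)" if "N \<le> n" for n using that by blast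
    have "y i = follow f N x i" for i
    proof (induction i)
      case 0
      then show ?case by (simp add: agree)
    next
      case (Suc i)
      then show ?case
        using agree[of "Suc i"] step[of i] by (cases "Suc i \<le> N") (simp_all add: follow_Suc)
    qed
    then show False using assms(2) by blast
  qed
  then show ?thesis using that by blast
qed

section \<open>From the space to the hyperspace\<close>

lemma funpow_image_shift_hyperspace:
  assumes "K \<in> hyperspace (SFT M) seq_dist"
  shows "(shift ^^ n) ` K \<in> hyperspace (SFT M) seq_dist"
  using assms
proof (induction n)
  case (Suc n)
  then show ?case using image_shift_hyperspace[of "(shift ^^ n) ` K" M] by (simp add: image_comp)
qed simp

lemma sensitive_SFT_imp_sensitive_hyperspace:
  fixes M :: "int ^ 'n::finite ^ 'n"
  assumes sens: "sensitive (SFT M) seq_dist shift"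
  shows "sensitive (hyperspace (SFT M) seq_dist) (hausdorff_dist seq_dist) (\<lambda>K. shift ` K)"
proof -
  interpret Metric_space "SFT M" seq_dist by (rule Metric_space_seq_dist)
  let ?H = "hyperspace (SFT M) seq_dist" and ?h = "hausdorff_dist seq_dist"
  obtain f where f: "\<And>x N. x \<in> SFT M \<Longrightarrow> follow f N x \<in> SFT M"
    using SFT_successor[of M] by blast
  have no_isolated: "\<exists>y\<in>SFT M. seq_dist x y < \<epsilon> \<and> y \<noteq> x" if "x \<in> SFT M" "\<epsilon> > 0" for x \<epsilon>
  proof -
    obtain \<delta> y n where "\<delta> > 0" "y \<in> SFT M" "seq_dist x y < \<epsilon>"
      and apart: "seq_dist ((shift ^^ n) x) ((shift ^^ n) y) > \<delta>"
      using sens \<open>x \<in> SFT M\<close> \<open>\<epsilon> > 0\<close> unfolding sensitive_def by meson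
    moreover have "y \<noteq> x"
      using apart \<open>\<delta> > 0\<close> mdist_zero[OF funpow_shift_SFT[OF \<open>x \<in> SFT M\<close>, of n]] by auto
    ultimately show ?thesis by blast
  qed
  have "\<exists>B\<in>?H. \<exists>n>0. ?h K B < \<epsilon> \<and> ?h ((shift ^^ n) ` K) ((shift ^^ n) ` B) > 1/8"
    if K: "K \<in> ?H" and "\<epsilon> > 0" for K \<epsilon>
  proof -
    obtain N0 where N0: "(1/2) ^ N0 < \<epsilon>"
      using real_arch_pow_inv[OF \<open>\<epsilon> > 0\<close>, of "1/2"] by auto
    \<comment> \<open>The extra \<open>Suc\<close> makes \<open>N\<close>, and hence the later time
      \<open>n \<ge> N\<close>, positive, as sensitivity demands.\<close>
    define N where "N = Suc N0"
    have N: "N > 0" "1 / 2 ^ N < \<epsilon>"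
    proof -
      have "(1/2 :: real) ^ N \<le> (1/2) ^ N0" unfolding N_def by (rule power_decreasing) auto
      then show "1 / 2 ^ N < \<epsilon>" using N0 by (simp add: power_divide)
    qed (simp add: N_def)
    have close: "seq_dist x z \<le> 1 / 2 ^ N" if "\<And>i. i \<le> N \<Longrightarrow> x i = z i" for x z :: "nat \<Rightarrow> 'n"
      using seq_dist_le_if_agree[of "Suc N" x z] that by simp
    define A where "A = follow f N ` K"
    have A_sub: "A \<subseteq> SFT M" using f hyperspaceD(2)[OF K] by (auto simp: A_def)
    have A_fin: "finite A"
      unfolding A_def by (rule finite_subset[OF _ finite_range_follow[of f N]]) auto
    obtain x where x: "x \<in> K" using hyperspaceD(1)[OF K] by blast
    \<comment> \<open>The radius \<open>1 / 2 ^ N\<close> forces agreement at every index up to and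
      including \<open>N\<close>, so the deviation from \<open>f\<close> comes no earlier than
      \<open>N\<close>.\<close>
    obtain y where y: "y \<in> SFT M" "seq_dist (follow f N x) y < 1 / 2 ^ N" "y \<noteq> follow f N x"
      using no_isolated[of "follow f N x" "1 / 2 ^ N"] A_sub x by (auto simp: A_def)
    have y_agree: "y i = follow f N x i" if "i \<le> N" for i
      using seq_dist_less_imp_agree[OF y(2) that] by simp
    obtain n where n: "N \<le> n" "y (Suc n) \<noteq> f (y n)"
      using follow_deviation[OF y_agree y(3)] by blast
    have A: "A \<in> ?H" and yA: "insert y A \<in> ?H"
      using A_sub A_fin y(1) x by (auto simp: hyperspace_def finite_imp_compactin A_def)
    have le: "?h K B \<le> 1 / 2 ^ N" if "B = A \<or> B = insert y A" for B
    proof -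
      have B: "B \<in> ?H" using A yA that by blast
      have "\<exists>b\<in>B. seq_dist z b \<le> 1 / 2 ^ N" if "z \<in> K" for z
        using close[of z "follow f N z"] \<open>B = A \<or> B = insert y A\<close> that by (auto simp: A_def)
      moreover have "\<exists>z\<in>K. seq_dist z b \<le> 1 / 2 ^ N" if "b \<in> B" for b
      proof -
        have "b \<in> A \<or> b = y" using \<open>B = A \<or> B = insert y A\<close> that by blast
        then obtain z where "z \<in> K" "\<And>i. i \<le> N \<Longrightarrow> z i = b i"
          using x y_agree by (auto simp: A_def)
        then show ?thesis using close by blast
      qed
      ultimately show ?thesis unfolding hausdorff_dist_le_iff[OF K B] by blast
    qed
    have near: "?h K A < \<epsilon>" "?h K (insert y A) < \<epsilon>"
      using le[of A] le[of "insert y A"] N(2) by auto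
    let ?S = "\<lambda>B. (shift ^^ n) ` B"
    have S: "?S K \<in> ?H" "?S A \<in> ?H" "?S (insert y A) \<in> ?H"
      by (rule funpow_image_shift_hyperspace, fact)+
    have far: "1/2 \<le> seq_dist ((shift ^^ n) a) ((shift ^^ n) y)" if "a \<in> A" for a
    proof -
      \<comment> \<open>If \<open>a\<close> and \<open>y\<close> agree at \<open>n\<close>, they
        differ at \<open>Suc n\<close>. After \<open>n\<close> shifts this is index 1 at the latest,
        whose weight is 1/2.\<close>
      have "a (Suc n) = f (a n)" using that n(1) by (auto simp: A_def follow_Suc)
      then have "(shift ^^ n) a 0 \<noteq> (shift ^^ n) y 0 \<or> (shift ^^ n) a 1 \<noteq> (shift ^^ n) y 1"
        using n(2) by (auto simp: funpow_shift)
      then show ?thesis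
        using seq_dist_ge_if_differ[of "(shift ^^ n) a" 0 "(shift ^^ n) y"]
          seq_dist_ge_if_differ[of "(shift ^^ n) a" 1 "(shift ^^ n) y"] by auto
    qed
    \<comment> \<open>The image of \<open>y\<close> has no point of \<open>?S A\<close> within 1/4.
      The triangle inequality through \<open>?S K\<close> splits this gap into two, one of them
      above 1/8.\<close>
    have "\<not> ?h (?S A) (?S (insert y A)) \<le> 1/4"
      unfolding hausdorff_dist_le_iff[OF S(2,3)] using far by force
    moreover have "?h (?S A) (?S (insert y A)) \<le> ?h (?S A) (?S K) + ?h (?S K) (?S (insert y A))"
      by (rule hausdorff_dist_triangle[OF S(2,1,3)])
    moreover have "?h (?S A) (?S K) = ?h (?S K) (?S A)"
      by (rule hausdorff_dist_commute) (rule commute)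
    ultimately have "?h (?S K) (?S A) > 1/8 \<or> ?h (?S K) (?S (insert y A)) > 1/8" by linarith
    moreover have "n > 0" using n(1) N(1) by linarith
    ultimately show ?thesis using A yA near by blast
  qed
  then show ?thesis
    unfolding sensitive_def funpow_image by (intro exI[of _ "1/8"]) auto
qed

theorem proposition3p7:
  fixes M :: "int ^ 'n::finite ^ 'n"
  assumes "\<forall>i j. M $ i $ j \<in> {0, 1}"
  shows "sensitive (SFT M) seq_dist shift \<longleftrightarrow>
    sensitive (hyperspace (SFT M) seq_dist) (hausdorff_dist seq_dist) (\<lambda>K. shift ` K)"
  using sensitive_SFT_imp_sensitive_hyperspace
    sensitive_hyperspace_imp_sensitive[OF Metric_space_seq_dist continuous_map_shift]
  by blast

end
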